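(* No mechanism simultaneously satisfies ex-post favoring-eagerness-for-remaining-items (ep-FERI), strong equal treatment of equals (SETE), and sd-strategyproofness (sd-SP).
   Context: Setting. An assignment problem has a set $N=\{1,\dots,n\}$ of agents and a set $M$ of $n$ items (one unit each). A preference profile $R=(\succ_j)_{j\in N}$ gives each agent $j$ a strict linear order $\succ_j$ on $M$. For nonempty $S\subseteq M$, $\mathrm{top}(j,S)$ is the $\succ_j$-best item of $S$; $rk(j,o)$ is the rank of $o$ in $\succ_j$ ($1$ = best). A random assignment is a doubly stochastic $n\times n$ matrix $P=[p_{j,o}]$ with rows $P_j$. A deterministic assignment is a bijection $A:N\to M$, identified with its permutation matrix. A mechanism $f$ assigns to every preference profile (of every assignment problem, of any size $n$) a random assignment; it satisfies a property of random assignments if its output satisfies it for every profile. FERI. For a deterministic assignment $A$ define recursively for $r=1,2,\dots$: $T_{A,r}=\{o\in M: o=\mathrm{top}(j,M\setminus\bigcup_{r'<r}T_{A,r'})\text{ for some }j\in N\text{ with }A(j)\notin\bigcup_{r'<r}T_{A,r'}\}$. $A$ satisfies FERI if for every $r\ge 1$ and every $o\in T_{A,r}$, $o=\mathrm{top}(A^{-1}(o),M\setminus\bigcup_{r'<r}T_{A,r'})$. A random assignment satisfies ep-FERI if it is a convex combination of deterministic assignments satisfying FERI. SETE: for agents $j,k$, their common prefix is the set $M'\subseteq M$ such that $rk(j,o)=rk(k,o)\le|M'|$ for all $o\in M'$ and $\mathrm{top}(j,M\setminus M')\neq\mathrm{top}(k,M\setminus M')$ (with $M'=M$ if $\succ_j=\succ_k$).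 $P$ satisfies SETE if $p_{j,o}=p_{k,o}$ for all $j,k\in N$ and all $o$ in the common prefix of $j$ and $k$. Stochastic dominance. $U(\succ,o)=\{o'\in M:o'\succ o\}\cup\{o\}$. For probability vectors $p,q$ on $M$, $p\succeq^{sd}_jq$ means $\sum_{o'\in U(\succ_j,o)}p_{o'}\ge\sum_{o'\in U(\succ_j,o)}q_{o'}$ for all $o\in M$. sd-SP: $f$ is sd-SP if for every profile $R$, every $j\in N$ and every $R'=(\succ'_j,\succ_{-j})$ obtained from $R$ by changing only $j$'s preference, $f(R)_j\succeq^{sd}_jf(R')_j$ (with respect to $\succ_j$). *)

theory Defs
  imports "HOL-Library.FuncSet" "HOL-Library.Infinite_Typeclass" Complex_Main
begin

(* The agents of a problem with item set M are 1, ..., n, where n is the number of items. *)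
definition agents :: "'i set \<Rightarrow> nat set" where
  "agents M = {1..card M}"

definition problem :: "'i set \<Rightarrow> bool" where
  "problem M \<longleftrightarrow> finite M \<and> M \<noteq> {}"

(* (a, b) in r means that a is strictly preferred to b. *)
definition preferences :: "'i set \<Rightarrow> 'i rel set" where
  "preferences M = {r. r \<subseteq> M \<times> M \<and> strict_linear_order_on M r}"

type_synonym 'i profile = "nat \<Rightarrow> 'i rel"

(* Profiles and assignments are extensional functions on the agents, so values outside the
   agents carry no information. *)
definition profiles :: "'i set \<Rightarrow> 'i profile set" where
  "profiles M = agents M \<rightarrow>\<^sub>E preferences M"

(* Only meaningful for nonempty subsets S of the items. *)
definition top_item :: "'i rel \<Rightarrow> 'i set \<Rightarrow> 'i" where
  "top_item r S = (THE a. a \<in> S \<and> (\<forall>b\<in>S. b \<noteq> a \<longrightarrow> (a, b) \<in> r))"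

definition upper :: "'i set \<Rightarrow> 'i rel \<Rightarrow> 'i \<Rightarrow> 'i set" where
  "upper M r a = {b \<in> M. (b, a) \<in> r} \<union> {a}"

definition rk :: "'i set \<Rightarrow> 'i rel \<Rightarrow> 'i \<Rightarrow> nat" where
  "rk M r a = card {b \<in> M. (b, a) \<in> r} + 1"

type_synonym 'i matrix = "nat \<Rightarrow> 'i \<Rightarrow> real"

definition random_assignment :: "'i set \<Rightarrow> 'i matrix \<Rightarrow> bool" where
  "random_assignment M P \<longleftrightarrow>
     (\<forall>j\<in>agents M. \<forall>a\<in>M. 0 \<le> P j a) \<and>
     (\<forall>j\<in>agents M. (\<Sum>a\<in>M. P j a) = 1) \<and>
     (\<forall>a\<in>M. (\<Sum>j\<in>agents M. P j a) = 1)"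

definition deterministic_assignments :: "'i set \<Rightarrow> (nat \<Rightarrow> 'i) set" where
  "deterministic_assignments M = {A \<in> agents M \<rightarrow>\<^sub>E M. bij_betw A (agents M) M}"

definition permutation_matrix :: "(nat \<Rightarrow> 'i) \<Rightarrow> 'i matrix" where
  "permutation_matrix A j a = (if A j = a then 1 else 0)"

(* Rounds are numbered from 1. *)
fun T :: "'i set \<Rightarrow> 'i profile \<Rightarrow> (nat \<Rightarrow> 'i) \<Rightarrow> nat \<Rightarrow> 'i set" where
  "T M R A r = {a \<in> M. \<exists>j\<in>agents M.
     A j \<notin> (\<Union>r'\<in>{1..<r}. T M R A r') \<and> a = top_item (R j) (M - (\<Union>r'\<in>{1..<r}. T M R A r'))}"

declare T.simps [simp del]

definition FERI :: "'i set \<Rightarrow> 'i profile \<Rightarrow> (nat \<Rightarrow> 'i) \<Rightarrow> bool" where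
  "FERI M R A \<longleftrightarrow> (\<forall>r\<ge>1. \<forall>a\<in>T M R A r.
     a = top_item (R (inv_into (agents M) A a)) (M - (\<Union>r'\<in>{1..<r}. T M R A r')))"

definition ep_FERI :: "'i set \<Rightarrow> 'i profile \<Rightarrow> 'i matrix \<Rightarrow> bool" where
  "ep_FERI M R P \<longleftrightarrow> (\<exists>w.
     (let D = {A \<in> deterministic_assignments M. FERI M R A} in
       (\<forall>A\<in>D. 0 \<le> w A) \<and> (\<Sum>A\<in>D. w A) = 1 \<and>
       (\<forall>j\<in>agents M. \<forall>a\<in>M. P j a = (\<Sum>A\<in>D. w A * permutation_matrix A j a))))"

definition is_common_prefix :: "'i set \<Rightarrow> 'i rel \<Rightarrow> 'i rel \<Rightarrow> 'i set \<Rightarrow> bool" where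
  "is_common_prefix M r s C \<longleftrightarrow>
     (if r = s then C = M
      else C \<subset> M \<and> (\<forall>a\<in>C. rk M r a = rk M s a \<and> rk M r a \<le> card C) \<and>
           top_item r (M - C) \<noteq> top_item s (M - C))"

definition SETE :: "'i set \<Rightarrow> 'i profile \<Rightarrow> 'i matrix \<Rightarrow> bool" where
  "SETE M R P \<longleftrightarrow> (\<forall>j\<in>agents M. \<forall>k\<in>agents M. \<forall>C.
     is_common_prefix M (R j) (R k) C \<longrightarrow> (\<forall>a\<in>C. P j a = P k a))"

definition sd_dominates :: "'i set \<Rightarrow> 'i rel \<Rightarrow> ('i \<Rightarrow> real) \<Rightarrow> ('i \<Rightarrow> real) \<Rightarrow> bool" where
  "sd_dominates M r p q \<longleftrightarrow>
     (\<forall>a\<in>M. (\<Sum>b\<in>upper M r a. p b) \<ge> (\<Sum>b\<in>upper M r a. q b))"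

type_synonym 'i mechanism = "'i set \<Rightarrow> 'i profile \<Rightarrow> 'i matrix"

(* A property of random assignments, lifted to mechanisms. *)
definition satisfies ::
  "'i mechanism \<Rightarrow> ('i set \<Rightarrow> 'i profile \<Rightarrow> 'i matrix \<Rightarrow> bool) \<Rightarrow> bool" where
  "satisfies f \<Phi> \<longleftrightarrow> (\<forall>M R. problem M \<longrightarrow> R \<in> profiles M \<longrightarrow> \<Phi> M R (f M R))"

definition is_mechanism :: "'i mechanism \<Rightarrow> bool" where
  "is_mechanism f \<longleftrightarrow> satisfies f (\<lambda>M R. random_assignment M)"

definition sd_SP :: "'i mechanism \<Rightarrow> bool" where
  "sd_SP f \<longleftrightarrow> (\<forall>M R j r'. problem M \<longrightarrow> R \<in> profiles M \<longrightarrow> j \<in> agents M \<longrightarrow>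
     r' \<in> preferences M \<longrightarrow> sd_dominates M (R j) (f M R j) (f M (R(j := r')) j))"

end

theory Submission
  imports Defs
begin

(* Two four-agent profiles suffice. If agents 1, 2, 3 rank a > b > c > d and agent 4 ranks
   b > a > c > d, then b goes to agent 4 with certainty and agents 1, 2, 3 share a equally, so
   agent 1 gets one of a, b with probability at most 1/3. If agent 1 instead copies agent 4, these
   two share b, and agent 1 gets b with probability 1/2, contradicting sd-SP. *)

text \<open>Uniqueness for the \<open>THE\<close>: two different best items would each be preferred
  to the other, and transitivity would put a reflexive pair into the order.\<close>

lemma top_item_eqI:
  assumes "irrefl r" and "trans r" and "a \<in> S" and "\<And>b. b \<in> S \<Longrightarrow> b \<noteq> a \<Longrightarrow> (a, b) \<in> r"
  shows "top_item r S = a"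
  unfolding top_item_def
proof (rule the_equality)
  fix x assume "x \<in> S \<and> (\<forall>b\<in>S. b \<noteq> x \<longrightarrow> (x, b) \<in> r)"
  then show "x = a"
    using assms by (metis irrefl_def transD)
qed (use assms in blast)

text \<open>Before round 1 nothing has been removed, so the favourite of \<open>j\<close> lies in
  \<open>T M R A 1\<close> whatever \<open>A\<close> gives to \<open>j\<close>. FERI at round 1 then
  speaks about its owner \<open>k\<close>.\<close>

lemma FERI_top_owner:
  assumes "FERI M R A" and A: "A \<in> deterministic_assignments M"
    and "j \<in> agents M" and "top_item (R j) M \<in> M" and "k \<in> agents M" and "A k = top_item (R j) M"
  shows "top_item (R k) M = top_item (R j) M"
proof -
  have "inj_on A (agents M)"
    using A by (auto simp: deterministic_assignments_def bij_betw_def)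
  then have "inv_into (agents M) A (top_item (R j) M) = k"
    using assms(5,6) by (metis inv_into_f_f)
  moreover have "top_item (R j) M \<in> T M R A 1"
    using assms(3,4) by (subst T.simps) auto
  ultimately show ?thesis
    using assms(1) unfolding FERI_def by fastforce
qed

text \<open>No FERI assignment in the convex combination gives this item to \<open>k\<close>, so
  every summand vanishes.\<close>

lemma ep_FERI_top_zero:
  assumes "ep_FERI M R P" and "j \<in> agents M" and "top_item (R j) M \<in> M"
    and "k \<in> agents M" and "top_item (R k) M \<noteq> top_item (R j) M"
  shows "P k (top_item (R j) M) = 0"
proof -
  from assms(1) obtain w where
    "P k (top_item (R j) M) = (\<Sum>A | A \<in> deterministic_assignments M \<and> FERI M R A.
       w A * permutation_matrix A k (top_item (R j) M))"
    using assms(3,4) unfolding ep_FERI_def Let_def by blast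
  also have "\<dots> = 0"
    using FERI_top_owner[of M R _ j k] assms(2-5)
    by (intro sum.neutral) (auto simp: permutation_matrix_def)
  finally show ?thesis .
qed

lemma SETE_equal_preferences:
  assumes "SETE M R P" and "j \<in> agents M" and "k \<in> agents M" and "R j = R k" and "a \<in> M"
  shows "P j a = P k a"
  using assms unfolding SETE_def is_common_prefix_def by metis

text \<open>Listing all six pairs reduces transitivity and totality to finite case checks.\<close>

definition order4 :: "'i \<Rightarrow> 'i \<Rightarrow> 'i \<Rightarrow> 'i \<Rightarrow> 'i rel" where
  "order4 a b c d = {(a, b), (a, c), (a, d), (b, c), (b, d), (c, d)}"

lemma order4_preferences:
  assumes "distinct [a, b, c, d]"
  shows "order4 a b c d \<in> preferences {a, b, c, d}"
  using assms
  by (auto simp: order4_def preferences_def strict_linear_order_on_def trans_def irrefl_def total_on_def)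

lemma top_item_order4:
  assumes "distinct [a, b, c, d]"
  shows "top_item (order4 a b c d) {a, b, c, d} = a"
  using order4_preferences[OF assms]
  by (intro top_item_eqI) (auto simp: preferences_def strict_linear_order_on_def order4_def)

lemma upper_order4_second:
  assumes "distinct [a, b, c, d]"
  shows "upper {a, b, c, d} (order4 a b c d) b = {a, b}"
  using assms by (auto simp: upper_def order4_def)

(* Mechanisms are defined for all finite item sets in the type 'i; an infinite type makes
   problems of every size available. *)
theorem proposition6:
  "\<not> (\<exists>f :: ('i :: infinite) mechanism.
       is_mechanism f \<and> satisfies f ep_FERI \<and> satisfies f SETE \<and> sd_SP f)"
proof
  assume "\<exists>f :: 'i mechanism.
    is_mechanism f \<and> satisfies f ep_FERI \<and> satisfies f SETE \<and> sd_SP f"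
  then obtain f :: "'i mechanism" where f: "is_mechanism f" "satisfies f ep_FERI"
    "satisfies f SETE" "sd_SP f"
    by blast
  obtain g :: "nat \<Rightarrow> 'i" where "inj g"
    using infinite_UNIV infinite_countable_subset by blast
  then obtain a b c d :: 'i where dist: "distinct [a, b, c, d]"
    by (intro that[of "g 0" "g 1" "g 2" "g 3"]) (simp add: inj_eq)
  define M where "M = {a, b, c, d}"
  define r where "r = order4 a b c d"
  define s where "s = order4 b a c d"
  \<comment> \<open>\<open>M'\<close> lists the same items in the order of \<open>s\<close>, so that
    the \<open>order4\<close> lemmas apply to \<open>s\<close> as well.\<close>
  have dist': "distinct [b, a, c, d]" and M': "M = {b, a, c, d}"
    using dist by (auto simp: M_def)
  have M: "problem M" "a \<in> M" "b \<in> M"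
    by (auto simp: M_def problem_def)
  have "card M = 4"
    using dist by (simp add: M_def)
  then have agents: "agents M = {1, 2, 3, 4}"
    by (auto simp: agents_def)
  have pref: "r \<in> preferences M" "s \<in> preferences M"
    using order4_preferences[OF dist] order4_preferences[OF dist']
    by (simp_all only: r_def s_def M_def[symmetric] M'[symmetric])
  have top: "top_item r M = a" "top_item s M = b"
    using top_item_order4[OF dist] top_item_order4[OF dist']
    by (simp_all only: r_def s_def M_def[symmetric] M'[symmetric])
  define R :: "'i profile" where
    "R = (\<lambda>j\<in>agents M. if j = 4 then s else r)"
  define R' where "R' = R(1 := s)"
  have R: "R 1 = r" "R 2 = r" "R 3 = r" "R 4 = s"
    by (simp_all add: R_def agents)
  have R': "R' 1 = s" "R' 2 = r" "R' 3 = r" "R' 4 = s"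
    by (simp_all add: R'_def R)
  have prof: "R \<in> profiles M" "R' \<in> profiles M"
    using pref by (auto simp: profiles_def R'_def R_def agents PiE_iff extensional_def)
  define P where "P = f M R"
  define P' where "P' = f M R'"
  have "random_assignment M P" "random_assignment M P'"
    using f(1) M prof by (auto simp: is_mechanism_def satisfies_def P_def P'_def)
  then have sum: "(\<Sum>j\<in>agents M. P j a) = 1" "(\<Sum>j\<in>agents M. P' j b) = 1"
    and pos: "0 \<le> P 4 a" "0 \<le> P' 1 a"
    using M by (auto simp: random_assignment_def agents)
  have FERI: "ep_FERI M R P" "ep_FERI M R' P'" and SETE: "SETE M R P" "SETE M R' P'"
    using f(2,3) M prof by (auto simp: satisfies_def P_def P'_def)
  have "a \<noteq> b"
    using dist by simp
  \<comment> \<open>Agent 4 has favourite \<open>b\<close> in both profiles, which excludes from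
    \<open>b\<close> every agent whose favourite is \<open>a\<close>.\<close>
  then have zero: "P 1 b = 0" "P' 2 b = 0" "P' 3 b = 0"
    using ep_FERI_top_zero[OF FERI(1), of 4 1] ep_FERI_top_zero[OF FERI(2), of 4 2]
      ep_FERI_top_zero[OF FERI(2), of 4 3] M
    by (simp_all add: agents R R' top del: One_nat_def)
  have "P 1 a = P 2 a" "P 1 a = P 3 a" "P' 1 b = P' 4 b"
    using SETE_equal_preferences[OF SETE(1), of 1 2 a] SETE_equal_preferences[OF SETE(1), of 1 3 a]
      SETE_equal_preferences[OF SETE(2), of 1 4 b] M
    by (simp_all add: agents R R' del: One_nat_def)
  \<comment> \<open>Column \<open>a\<close> of \<open>P\<close> reads 3 * \<open>P 1 a\<close> +
    \<open>P 4 a\<close> = 1, and column \<open>b\<close> of \<open>P'\<close> reads 2 *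
    \<open>P' 1 b\<close> = 1.\<close>
  then have third: "P 1 a \<le> 1/3" and half: "P' 1 b = 1/2"
    using sum pos zero by (auto simp: agents)
  have "sd_dominates M r (P 1) (P' 1)"
    using f(4) M(1) prof(1) pref(2) unfolding sd_SP_def P_def P'_def R'_def R(1)[symmetric]
    by (simp add: agents del: One_nat_def)
  \<comment> \<open>Dominance is evaluated at \<open>b\<close>, the second item of the true order
    \<open>r\<close>. The left side is at least 1/2 and the right side at most 1/3.\<close>
  then have "(\<Sum>x\<in>{a, b}. P' 1 x) \<le> (\<Sum>x\<in>{a, b}. P 1 x)"
    using M(3) upper_order4_second[OF dist, folded M_def r_def]
    unfolding sd_dominates_def by fastforce
  then show False
    using \<open>a \<noteq> b\<close> third half zero pos by simp
qed

end
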